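(* There is an absolute constant $C$ such that the following holds. Let $\pi$ be a permutation with Füredi–Hajnal limit $c_\pi$. Then for every finite point set $P\subset[0,1]^2$ in general position that avoids $\pi$, we have $\mathrm{TSP}(P)\le C\, c_\pi\log|P|$.
   Context: A finite point set is in general position if no two points share an $x$- or $y$-coordinate. Such a set corresponds to the permutation obtained by listing its points by increasing $x$-coordinate and recording the ranks of their $y$-coordinates; the set contains (avoids) a permutation $\pi$ if this permutation contains (avoids) $\pi$, where a sequence contains $\pi$ if some subsequence is order-isomorphic to $\pi$ (same relative order of entries). Füredi–Hajnal limit: a 0-1 matrix $M$ contains a 0-1 matrix $Q$ if $Q$ can be obtained from a submatrix of $M$ by turning some 1-entries into 0; the permutation matrix of $\pi$ has a 1 in row $\pi_i$ of column $i$. $\mathrm{ex}_\pi(n)$ is the maximum number of 1s in an $n\times n$ 0-1 matrix not containing the permutation matrix of $\pi$, and $c_\pi=\lim_{n\to\infty}\mathrm{ex}_\pi(n)/n$. $\mathrm{TSP}(P)$ denotes the minimum Euclidean length of a closed tour visiting all points of $P$. *)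

theory Defs
  imports
    "HOL-Analysis.Analysis"
    "HOL-Combinatorics.Multiset_Permutations"
    "HOL-Library.Sublist"
    "Jordan_Normal_Form.DL_Submatrix"
begin

section \<open>Permutation patterns\<close>

text \<open>Permutations of length \<open>k\<close> are written in one-line notation, as elements of
  \<open>permutations_of_set {1..k}\<close>; the entry \<open>\<pi>\<^sub>i\<close> is \<open>\<pi> ! (i - 1)\<close>.\<close>

definition order_isomorphic :: "'a::linorder list \<Rightarrow> 'b::linorder list \<Rightarrow> bool" where
  "order_isomorphic xs ys \<longleftrightarrow>
     length xs = length ys \<and>
     (\<forall>i<length xs. \<forall>j<length xs. xs ! i < xs ! j \<longleftrightarrow> ys ! i < ys ! j)"

definition seq_contains :: "'a::linorder list \<Rightarrow> 'b::linorder list \<Rightarrow> bool" where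
  "seq_contains \<sigma> \<pi> \<longleftrightarrow> (\<exists>\<tau>. subseq \<tau> \<sigma> \<and> order_isomorphic \<tau> \<pi>)"

section \<open>Planar point sets\<close>

definition general_position :: "(real \<times> real) set \<Rightarrow> bool" where
  "general_position P \<longleftrightarrow> inj_on fst P \<and> inj_on snd P"

definition y_rank :: "(real \<times> real) set \<Rightarrow> real \<times> real \<Rightarrow> nat" where
  "y_rank P p = card {q \<in> P. snd q \<le> snd p}"

definition point_perm :: "(real \<times> real) set \<Rightarrow> nat list" where
  "point_perm P = map (y_rank P) (sorted_key_list_of_set fst P)"

definition points_avoid :: "(real \<times> real) set \<Rightarrow> nat list \<Rightarrow> bool" where
  "points_avoid P \<pi> \<longleftrightarrow> \<not> seq_contains (point_perm P) \<pi>"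

section \<open>Euclidean tours\<close>

text \<open>The distance on \<open>real \<times> real\<close> is the Euclidean one.  Pairing a list with its rotation
  includes the closing edge from the last point back to the first; a two-point tour
  traverses its segment twice, and tours with at most one point have length 0.\<close>

definition tour_length :: "(real \<times> real) list \<Rightarrow> real" where
  "tour_length xs = sum_list (map2 dist xs (rotate1 xs))"

definition TSP :: "(real \<times> real) set \<Rightarrow> real" where
  "TSP P = Min (tour_length ` permutations_of_set P)"

section \<open>The Fueredi--Hajnal limit\<close>

definition zero_one_mats :: "nat \<Rightarrow> nat mat set" where
  "zero_one_mats n = {M \<in> carrier_mat n n. elements_mat M \<subseteq> {0, 1}}"

definition mat_contains :: "nat mat \<Rightarrow> nat mat \<Rightarrow> bool" where
  "mat_contains M Q \<longleftrightarrow>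
     (\<exists>I J. submatrix M I J \<in> carrier_mat (dim_row Q) (dim_col Q) \<and>
        (\<forall>i<dim_row Q. \<forall>j<dim_col Q. Q $$ (i, j) = 1 \<longrightarrow> submatrix M I J $$ (i, j) = 1))"

text \<open>Rows and columns of matrices are indexed from 0, entries of permutations start at 1.\<close>

definition perm_mat :: "nat list \<Rightarrow> nat mat" where
  "perm_mat \<pi> = mat (length \<pi>) (length \<pi>) (\<lambda>(i, j). if \<pi> ! j = Suc i then 1 else 0)"

definition num_ones :: "nat mat \<Rightarrow> nat" where
  "num_ones M = card {(i, j). i < dim_row M \<and> j < dim_col M \<and> M $$ (i, j) = 1}"

definition ex_perm :: "nat list \<Rightarrow> nat \<Rightarrow> nat" where
  "ex_perm \<pi> n = Max {num_ones M | M. M \<in> zero_one_mats n \<and> \<not> mat_contains M (perm_mat \<pi>)}"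

text \<open>The limit exists for every permutation of positive length (Marcus--Tardos).\<close>

definition FH_limit :: "nat list \<Rightarrow> real" where
  "FH_limit \<pi> = lim (\<lambda>n. real (ex_perm \<pi> n) / real n)"

end

theory Submission
  imports Defs
begin

text \<open>Cut the unit square into \<open>m \<times> m\<close> cells.  One point per nonempty cell shows that the matrix of
  nonempty cells avoids \<open>\<pi>\<close>, so there are \<open>O(c\<^sub>\<pi> m)\<close> of them.  Inserting a point \<open>p\<close> into a tour next
  to \<open>q\<close> costs at most \<open>2 d(p, q)\<close>; with \<open>q\<close> in the smallest occupied dyadic cell around \<open>p\<close>, the cost
  is charged to the dyadic cells that \<open>p\<close> newly occupies.  A cell of side \<open>2\<^sup>-\<^sup>j\<close> is charged \<open>O(2\<^sup>-\<^sup>j)\<close>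
  once, hence each of the \<open>O(log |P|)\<close> relevant scales contributes \<open>O(c\<^sub>\<pi>)\<close>.  That the limit \<open>c\<^sub>\<pi>\<close>
  exists and bounds \<open>ex\<^sub>\<pi>(m) / m\<close> follows from the Marcus--Tardos theorem and Fekete's lemma.\<close>

section \<open>Pattern occurrences\<close>

text \<open>Only strict inequalities are kept and the target orders are arbitrary, so that 1-entries
  of matrices, block indices and real points are treated alike. Ties in \<open>Q\<close> impose no
  condition; distinct 1-entries of a permutation matrix never tie.\<close>

definition occurs :: "(nat \<times> nat) set \<Rightarrow> ('a::linorder \<times> 'b::linorder) set \<Rightarrow> bool" where
  "occurs Q S \<longleftrightarrow> (\<exists>\<phi>. \<phi> ` Q \<subseteq> S \<and>
     (\<forall>a\<in>Q. \<forall>b\<in>Q. (fst a < fst b \<longrightarrow> fst (\<phi> a) < fst (\<phi> b)) \<and>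
                    (snd a < snd b \<longrightarrow> snd (\<phi> a) < snd (\<phi> b))))"

lemma occursI:
  assumes "\<And>a. a \<in> Q \<Longrightarrow> \<phi> a \<in> S"
    and "\<And>a b. a \<in> Q \<Longrightarrow> b \<in> Q \<Longrightarrow> fst a < fst b \<Longrightarrow> fst (\<phi> a) < fst (\<phi> b)"
    and "\<And>a b. a \<in> Q \<Longrightarrow> b \<in> Q \<Longrightarrow> snd a < snd b \<Longrightarrow> snd (\<phi> a) < snd (\<phi> b)"
  shows "occurs Q S"
  unfolding occurs_def using assms by blast

lemma occursE:
  assumes "occurs Q S"
  obtains \<phi> where "\<And>a. a \<in> Q \<Longrightarrow> \<phi> a \<in> S"
    and "\<And>a b. a \<in> Q \<Longrightarrow> b \<in> Q \<Longrightarrow> fst a < fst b \<Longrightarrow> fst (\<phi> a) < fst (\<phi> b)"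
    and "\<And>a b. a \<in> Q \<Longrightarrow> b \<in> Q \<Longrightarrow> snd a < snd b \<Longrightarrow> snd (\<phi> a) < snd (\<phi> b)"
  using assms unfolding occurs_def image_subset_iff by metis

text \<open>Transposition, used to obtain the bound on tall blocks from the one on wide
  blocks.\<close>

lemma occurs_swap: "occurs (prod.swap ` Q) (prod.swap ` S) \<longleftrightarrow> occurs Q S"
proof -
  have *: "occurs (prod.swap ` Q) (prod.swap ` S)" if occ: "occurs Q S"
    for Q and S :: "('c::linorder \<times> 'd::linorder) set"
  proof -
    obtain \<phi> where "\<And>a. a \<in> Q \<Longrightarrow> \<phi> a \<in> S"
      and "\<And>a b. a \<in> Q \<Longrightarrow> b \<in> Q \<Longrightarrow> fst a < fst b \<Longrightarrow> fst (\<phi> a) < fst (\<phi> b)"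
      and "\<And>a b. a \<in> Q \<Longrightarrow> b \<in> Q \<Longrightarrow> snd a < snd b \<Longrightarrow> snd (\<phi> a) < snd (\<phi> b)"
      using occ by (rule occursE) blast
    then show ?thesis
      by (intro occursI[where \<phi> = "prod.swap \<circ> \<phi> \<circ> prod.swap"]) auto
  qed
  have inv: "prod.swap ` prod.swap ` X = X" for X :: "('e \<times> 'f) set"
    by (simp add: image_comp)
  show ?thesis
    using *[of Q S] *[of "prod.swap ` Q" "prod.swap ` S"] unfolding inv by blast
qed

text \<open>A weakly increasing map reflects strict inequalities, so arbitrary preimages of an
  occurrence form an occurrence. This serves the block contraction, the shifts in the
  superadditivity proof and the passage from cells to points.\<close>

lemma occurs_map_prod:
  assumes "mono_on (fst ` S) u" "mono_on (snd ` S) v" "occurs Q (map_prod u v ` S)"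
  shows "occurs Q S"
proof -
  obtain \<phi> where \<phi>: "\<And>a. a \<in> Q \<Longrightarrow> \<phi> a \<in> map_prod u v ` S"
      "\<And>a b. a \<in> Q \<Longrightarrow> b \<in> Q \<Longrightarrow> fst a < fst b \<Longrightarrow> fst (\<phi> a) < fst (\<phi> b)"
      "\<And>a b. a \<in> Q \<Longrightarrow> b \<in> Q \<Longrightarrow> snd a < snd b \<Longrightarrow> snd (\<phi> a) < snd (\<phi> b)"
    using assms(3) by (rule occursE) blast
  define \<psi> where "\<psi> = inv_into S (map_prod u v) \<circ> \<phi>"
  have mem: "\<psi> a \<in> S" and eq: "map_prod u v (\<psi> a) = \<phi> a" if "a \<in> Q" for a
    using \<phi>(1)[OF that] by (auto simp: \<psi>_def inv_into_into f_inv_into_f)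
  have eqs: "u (fst (\<psi> a)) = fst (\<phi> a)" "v (snd (\<psi> a)) = snd (\<phi> a)" if "a \<in> Q" for a
    using eq[OF that] by (metis fst_map_prod, metis snd_map_prod)
  show ?thesis
  proof (rule occursI[where \<phi> = \<psi>])
    fix a b assume ab: "a \<in> Q" "b \<in> Q"
    show "fst (\<psi> a) < fst (\<psi> b)" if "fst a < fst b"
    proof (rule ccontr)
      assume "\<not> fst (\<psi> a) < fst (\<psi> b)"
      then have "u (fst (\<psi> b)) \<le> u (fst (\<psi> a))"
        using mem ab by (intro mono_onD[OF assms(1)]) auto
      then show False using \<phi>(2)[OF ab that] eqs ab by simp
    qed
    show "snd (\<psi> a) < snd (\<psi> b)" if "snd a < snd b"
    proof (rule ccontr)
      assume "\<not> snd (\<psi> a) < snd (\<psi> b)"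
      then have "v (snd (\<psi> b)) \<le> v (snd (\<psi> a))"
        using mem ab by (intro mono_onD[OF assms(2)]) auto
      then show False using \<phi>(3)[OF ab that] eqs ab by simp
    qed
  qed (rule mem)
qed

section \<open>The Marcus--Tardos theorem\<close>

lemma div_eq_interval:
  assumes "0 < (q::nat)"
  shows "{y. y div q = c} = {c * q..<c * q + q}"
  using assms by (auto simp: div_nat_eqI mult.commute add.commute dividend_less_times_div)

text \<open>Pigeonhole: among too many such blocks, \<open>k\<close> occupy the same set of at least \<open>k\<close> columns, and
  those blocks and columns serve as the rows and columns of an occurrence of \<open>Q\<close>.\<close>

lemma card_wide_blocks:
  fixes S :: "(nat \<times> nat) set"
  assumes Q: "Q \<subseteq> {..<k} \<times> {..<k}" and av: "\<not> occurs Q S" and "0 < q" and fin: "finite W"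
    and wide: "\<And>b. b \<in> W \<Longrightarrow> k \<le> card (snd ` {s \<in> S. fst s div q = b \<and> snd s div q = c})"
  shows "card W \<le> k * 2 ^ q"
proof (rule ccontr)
  assume big: "\<not> card W \<le> k * 2 ^ q"
  define h where "h b = snd ` {s \<in> S. fst s div q = b \<and> snd s div q = c}" for b
  let ?B = "{c * q..<c * q + q}"
  have hB: "h b \<subseteq> ?B" for b
  proof
    fix y assume "y \<in> h b"
    then show "y \<in> ?B" using div_eq_interval[OF \<open>0 < q\<close>, of c] by (auto simp: h_def)
  qed
  obtain T where T: "card W \<le> card (h -` {T} \<inter> W) * card (Pow ?B)"
    using pigeonhole_card[of h W "Pow ?B"] hB fin by auto
  define V where "V = h -` {T} \<inter> W"
  have "card W \<le> card V * 2 ^ q" using T by (simp add: card_Pow V_def)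
  then have "k * 2 ^ q < card V * 2 ^ q" using big by linarith
  then have kV: "k < card V" by simp
  then obtain b0 where "b0 \<in> V" by fastforce
  then have T0: "T = h b0" "k \<le> card T" using wide by (auto simp: V_def h_def)
  have finT: "finite T" using T0 hB finite_subset by blast
  have ex: "\<exists>s. s \<in> S \<and> fst s div q = pick V i \<and> snd s = pick T j" if "i < k" "j < k" for i j
  proof -
    have "pick V i \<in> V" by (rule pick_in_set) (use that kV in simp)
    then have "h (pick V i) = T" by (simp add: V_def)
    moreover have "pick T j \<in> T" by (rule pick_in_set) (use that T0 in simp)
    ultimately show ?thesis by (auto simp: h_def image_iff)
  qed
  define \<phi> where "\<phi> a = (SOME s. s \<in> S \<and> fst s div q = pick V (fst a) \<and> snd s = pick T (snd a))" for a
  have \<phi>: "\<phi> a \<in> S \<and> fst (\<phi> a) div q = pick V (fst a) \<and> snd (\<phi> a) = pick T (snd a)" if "a \<in> Q" for a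
    unfolding \<phi>_def by (rule someI_ex, rule ex) (use that Q in auto)
  have "occurs Q S"
  proof (rule occursI[where \<phi> = \<phi>])
    fix a b assume ab: "a \<in> Q" "b \<in> Q"
    have lt: "fst b < k" "snd b < k" using ab Q by auto
    show "fst (\<phi> a) < fst (\<phi> b)" if "fst a < fst b"
    proof -
      have "pick V (fst a) < pick V (fst b)"
        by (rule pick_mono) (use that lt kV in auto)
      then show ?thesis using \<phi> ab by (metis div_le_mono not_le)
    qed
    show "snd (\<phi> a) < snd (\<phi> b)" if "snd a < snd b"
      using pick_mono[of "snd b" T "snd a"] that lt T0 \<phi> ab by auto
  qed (use \<phi> in blast)
  then show False using av by simp
qed

text \<open>The previous bound for one strip of blocks, summed over the \<open>m\<close> strips
  \<open>c\<close>.\<close>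

lemma card_wide_block_pairs:
  fixes S :: "(nat \<times> nat) set"
  assumes Q: "Q \<subseteq> {..<k} \<times> {..<k}" and av: "\<not> occurs Q S" and "0 < q"
    and W: "W \<subseteq> {..<m} \<times> {..<m}"
    and wide: "\<And>b c. (b, c) \<in> W \<Longrightarrow> k \<le> card (snd ` {s \<in> S. fst s div q = b \<and> snd s div q = c})"
  shows "card W \<le> m * (k * 2 ^ q)"
proof -
  have "finite W" using W finite_subset by blast
  let ?W = "\<lambda>c. {b. (b, c) \<in> W}"
  have "finite (?W c)" for c
    by (rule finite_subset[of _ "fst ` W"]) (use \<open>finite W\<close> in force)+
  then have "card (?W c) \<le> k * 2 ^ q" for c
    by (intro card_wide_blocks[OF Q av \<open>0 < q\<close>, of _ c]) (use wide in auto)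
  moreover have "card W \<le> (\<Sum>c<m. card ((\<lambda>b. (b, c)) ` ?W c))"
  proof -
    have "card W = card (\<Union>c<m. (\<lambda>b. (b, c)) ` ?W c)"
      by (rule arg_cong[where f = card]) (use W in auto)
    also have "\<dots> \<le> (\<Sum>c<m. card ((\<lambda>b. (b, c)) ` ?W c))" by (rule card_UN_le) simp
    finally show ?thesis .
  qed
  moreover have "card ((\<lambda>b. (b, c)) ` ?W c) = card (?W c)" for c
    by (rule card_image) (simp add: inj_on_def)
  ultimately have "card W \<le> (\<Sum>c<m. k * 2 ^ q)"
    using sum_mono[of "{..<m}" "\<lambda>c. card (?W c)" "\<lambda>_. k * 2 ^ q"] by simp
  then show ?thesis by simp
qed

text \<open>The Marcus--Tardos recurrence. A block in which \<open>S\<close> meets at least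
  \<open>k\<close> columns or at least \<open>k\<close> rows holds at most \<open>q ^ 2\<close>
  points, and there are at most \<open>m * (k * 2 ^ q)\<close> blocks of either type; any other
  block holds at most \<open>(k - 1) ^ 2\<close> points.\<close>

lemma card_le_blocks:
  fixes S :: "(nat \<times> nat) set"
  assumes Q: "Q \<subseteq> {..<k} \<times> {..<k}" and av: "\<not> occurs Q S" and "0 < q" "0 < k"
    and T: "map_prod (\<lambda>i. i div q) (\<lambda>i. i div q) ` S \<subseteq> {..<m} \<times> {..<m}"
    and fin: "finite S"
  shows "card S \<le> (k - 1) ^ 2 * card (map_prod (\<lambda>i. i div q) (\<lambda>i. i div q) ` S) + 2 * k * q ^ 2 * 2 ^ q * m"
proof -
  let ?h = "map_prod (\<lambda>i. i div q) (\<lambda>i. i div q)"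
  define F where "F t = {s \<in> S. fst s div q = fst t \<and> snd s div q = snd t}" for t
  define W where "W = {t \<in> ?h ` S. k \<le> card (snd ` F t)}"
  define W' where "W' = {t \<in> ?h ` S. k \<le> card (fst ` F t)}"
  have finF: "finite (F t)" for t using fin by (simp add: F_def)
  have cW: "card W \<le> m * (k * 2 ^ q)"
    by (rule card_wide_block_pairs[OF Q av \<open>0 < q\<close>]) (use T in \<open>auto simp: W_def F_def\<close>)
  have cW': "card W' \<le> m * (k * 2 ^ q)"
  proof -
    \<comment> \<open>A tall block becomes a wide one under transposition, with its two block
      indices exchanged.\<close>
    have "card (prod.swap ` W') \<le> m * (k * 2 ^ q)"
    proof (rule card_wide_block_pairs)
      show "prod.swap ` Q \<subseteq> {..<k} \<times> {..<k}" using Q by auto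
      show "\<not> occurs (prod.swap ` Q) (prod.swap ` S)" using av by (simp add: occurs_swap)
      show "prod.swap ` W' \<subseteq> {..<m} \<times> {..<m}" using T by (auto simp: W'_def)
      fix b c assume "(b, c) \<in> prod.swap ` W'"
      then have "k \<le> card (fst ` F (c, b))" by (auto simp: W'_def)
      also have "fst ` F (c, b) = snd ` {s \<in> prod.swap ` S. fst s div q = b \<and> snd s div q = c}"
        by (force simp: F_def)
      finally show "k \<le> card (snd ` {s \<in> prod.swap ` S. fst s div q = b \<and> snd s div q = c})" .
    qed (fact)
    then show ?thesis by (simp add: card_image)
  qed
  have cF: "card (F t) \<le> (k - 1) ^ 2 + (if t \<in> W then q ^ 2 else 0) + (if t \<in> W' then q ^ 2 else 0)"
    if t: "t \<in> ?h ` S" for t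
  proof -
    have le: "card (F t) \<le> card (fst ` F t) * card (snd ` F t)"
    proof -
      have "card (F t) \<le> card (fst ` F t \<times> snd ` F t)"
        by (rule card_mono[OF _ subset_fst_snd]) (simp add: finF)
      then show ?thesis by (simp add: card_cartesian_product)
    qed
    note int = div_eq_interval[OF \<open>0 < q\<close>]
    have "card (fst ` F t) \<le> card {fst t * q..<fst t * q + q}"
      by (rule card_mono) (use int[of "fst t"] in \<open>auto simp: F_def\<close>)
    moreover have "card (snd ` F t) \<le> card {snd t * q..<snd t * q + q}"
      by (rule card_mono) (use int[of "snd t"] in \<open>auto simp: F_def\<close>)
    ultimately have lq: "card (F t) \<le> q ^ 2"
      using le mult_mono[of "card (fst ` F t)" q "card (snd ` F t)" q]
      by (simp add: power2_eq_square)
    show ?thesis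
    proof (cases "t \<in> W \<or> t \<in> W'")
      case False
      then have "card (fst ` F t) \<le> k - 1" "card (snd ` F t) \<le> k - 1"
        using t by (auto simp: W_def W'_def)
      then have "card (fst ` F t) * card (snd ` F t) \<le> (k - 1) ^ 2"
        unfolding power2_eq_square by (rule mult_mono) auto
      then show ?thesis using False le by simp
    qed (use lq in auto)
  qed
  have "card S = card (\<Union>t\<in>?h ` S. F t)"
    by (rule arg_cong[where f = card]) (auto simp: F_def)
  also have "\<dots> \<le> (\<Sum>t\<in>?h ` S. card (F t))" by (rule card_UN_le) (use fin in simp)
  also have "\<dots> \<le> (\<Sum>t\<in>?h ` S. (k - 1) ^ 2 + (if t \<in> W then q ^ 2 else 0) + (if t \<in> W' then q ^ 2 else 0))"
    by (rule sum_mono) (rule cF)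
  also have "\<dots> = (k - 1) ^ 2 * card (?h ` S) + q ^ 2 * card W + q ^ 2 * card W'"
  proof -
    have "?h ` S \<inter> W = W" "?h ` S \<inter> W' = W'" by (auto simp: W_def W'_def)
    then show ?thesis using fin by (simp add: sum.distrib flip: sum.inter_restrict)
  qed
  also have "\<dots> \<le> (k - 1) ^ 2 * card (?h ` S) + q ^ 2 * (m * (k * 2 ^ q)) + q ^ 2 * (m * (k * 2 ^ q))"
    by (intro add_mono mult_left_mono cW cW') auto
  finally show ?thesis by (simp add: algebra_simps)
qed

text \<open>Induction on \<open>n\<close> through the recurrence: the factor
  \<open>(k - 1) ^ 2\<close> is smaller than the contraction ratio \<open>q = k ^ 2\<close>, so a
  linear bound survives.\<close>

theorem marcus_tardos:
  assumes Q: "Q \<subseteq> {..<k} \<times> {..<k}" and "0 < k"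
  shows "\<exists>B. \<forall>n S. S \<subseteq> {..<n} \<times> {..<n} \<longrightarrow> \<not> occurs Q S \<longrightarrow> card S \<le> B * n"
proof -
  define q where "q = k ^ 2"
  define A where "A = 2 * k * q ^ 2 * 2 ^ q"
  \<comment> \<open>\<open>q ^ 2\<close> covers the base case, where
    \<open>card S \<le> n * n\<close>; \<open>2 * A\<close> absorbs the error term
    \<open>A * m\<close>, since \<open>m \<le> 2 * d\<close> for \<open>d = n div q\<close>.\<close>
  define B where "B = 2 * A + q ^ 2"
  have "0 < q" using \<open>0 < k\<close> by (simp add: q_def)
  have "card S \<le> B * n" if "S \<subseteq> {..<n} \<times> {..<n}" "\<not> occurs Q S" for n and S :: "(nat \<times> nat) set"
    using that
  proof (induction n arbitrary: S rule: less_induct)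
    case (less n)
    have finS: "finite S" using less.prems(1) finite_subset by blast
    show ?case
    proof (cases "n < q ^ 2")
      case True
      have "card S \<le> card ({..<n} \<times> {..<n})" by (rule card_mono) (use less.prems in auto)
      also have "\<dots> \<le> q ^ 2 * n" using True by simp
      finally show ?thesis by (simp add: B_def algebra_simps)
    next
      case False
      define m where "m = n div q + 1"
      show ?thesis
      \<comment> \<open>For \<open>k = 1\<close> also \<open>q = 1\<close>, and contraction would
        not shrink \<open>n\<close>. A pattern inside one cell occurs in every nonempty set.\<close>
      proof (cases "k = 1")
        case True
        have "S = {}"
        proof (rule ccontr)
          assume "S \<noteq> {}"
          then obtain s where "s \<in> S" by blast
          then have "occurs Q S"
            by (intro occursI[where \<phi> = "\<lambda>_. s"]) (use Q True in auto)
          then show False using less.prems by simp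
        qed
        then show ?thesis by simp
      next
        case k1: False
        let ?h = "map_prod (\<lambda>i. i div q) (\<lambda>i. i div q)"
        have "k \<ge> 2" using k1 \<open>0 < k\<close> by arith
        then have "q \<ge> 2 * 2" using mult_mono[of 2 k 2 k] by (simp add: q_def power2_eq_square)
        have hS: "?h ` S \<subseteq> {..<m} \<times> {..<m}"
        proof -
          have "x div q < m" if "x < n" for x
            using that by (simp add: m_def less_Suc_eq_le div_le_mono)
          then show ?thesis using less.prems(1) by auto
        qed
        have "n \<ge> q * q" using False by (simp add: power2_eq_square)
        then have "q \<le> n div q" using \<open>0 < q\<close> by (simp add: less_eq_div_iff_mult_less_eq)
        obtain r where n: "n = q * (n div q) + r" "r < q"
          using \<open>0 < q\<close> by (metis mod_less_divisor mult_div_mod_eq)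
        define d where "d = n div q"
        have d: "q \<le> d" "m = d + 1" "q * d \<le> n" using \<open>q \<le> n div q\<close> n by (auto simp: d_def m_def)
        have "4 * d \<le> q * d" using \<open>q \<ge> 2 * 2\<close> by (intro mult_right_mono) auto
        then have "m < n" using d \<open>q \<ge> 2 * 2\<close> by linarith
        moreover have "\<not> occurs Q (?h ` S)"
          using occurs_map_prod[of S "\<lambda>i. i div q" "\<lambda>i. i div q" Q] less.prems(2)
          by (auto simp: mono_on_def div_le_mono)
        ultimately have IH: "card (?h ` S) \<le> B * m" using less.IH hS by blast
        have "card S \<le> (k - 1) ^ 2 * card (?h ` S) + A * m"
          using card_le_blocks[OF Q less.prems(2) \<open>0 < q\<close> \<open>0 < k\<close> hS finS] by (simp add: A_def)
        also have "\<dots> \<le> (k - 1) ^ 2 * (B * m) + A * m"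
          using IH by simp
        also have "\<dots> \<le> B * (q * d)"
        proof -
          obtain l where l: "k = Suc l" using \<open>0 < k\<close> gr0_conv_Suc by auto
          \<comment> \<open>The three terms of \<open>q = (l + 1) ^ 2\<close> pay in turn for the
            main term \<open>l ^ 2 * d\<close>, for the extra \<open>l ^ 2\<close> due to
            \<open>m = d + 1\<close>, and for \<open>A * m\<close>.\<close>
          have ql: "q = l ^ 2 + 2 * l + 1" by (simp add: q_def l power2_eq_square)
          have "l ^ 2 \<le> d" using ql d by simp
          have "l \<ge> 1" using l \<open>k \<ge> 2\<close> by simp
          then have "1 * d \<le> 2 * l * d" by (intro mult_right_mono) auto
          then have "l ^ 2 \<le> 2 * l * d" using \<open>l ^ 2 \<le> d\<close> by linarith
          then have 1: "B * l ^ 2 \<le> B * (2 * l * d)" by simp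
          have "A * m \<le> A * (2 * d)" using d \<open>0 < q\<close> by (intro mult_left_mono) auto
          also have "\<dots> \<le> B * d" by (simp add: B_def algebra_simps)
          finally have 2: "A * m \<le> B * d" .
          have "(k - 1) ^ 2 * (B * m) + A * m = B * l ^ 2 * d + B * l ^ 2 + A * m"
            by (simp add: l d(2) algebra_simps)
          also have "\<dots> \<le> B * l ^ 2 * d + B * (2 * l * d) + B * d" using 1 2 by linarith
          also have "\<dots> = B * (q * d)" by (simp add: ql algebra_simps)
          finally show ?thesis .
        qed
        also have "\<dots> \<le> B * n" using d by simp
        finally show ?thesis .
      qed
    qed
  qed
  then show ?thesis by blast
qed

section \<open>The extremal function and its limit\<close>

text \<open>The 1-entries of \<open>perm_mat \<pi>\<close>, row first, so a value of the permutation
  precedes its position. Point sets are therefore swapped before they are compared with it.\<close>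

definition perm_rel :: "nat list \<Rightarrow> (nat \<times> nat) set" where
  "perm_rel \<pi> = {(i, j). j < length \<pi> \<and> \<pi> ! j = Suc i}"

lemma perm_rel_bounded:
  assumes "\<pi> \<in> permutations_of_set {1..k}"
  shows "perm_rel \<pi> \<subseteq> {..<k} \<times> {..<k}"
proof -
  have set: "set \<pi> = {1..k}" and len: "length \<pi> = k"
    using assms by (auto simp: permutations_of_set_def distinct_card[symmetric])
  have "i < k" if "j < k" "\<pi> ! j = Suc i" for i j
    using that len set nth_mem[of j \<pi>] by auto
  then show ?thesis using len by (auto simp: perm_rel_def)
qed

lemma perm_rel_total:
  assumes "\<pi> \<in> permutations_of_set {1..k}"
  shows "i < k \<Longrightarrow> \<exists>j. (i, j) \<in> perm_rel \<pi>" "j < k \<Longrightarrow> \<exists>i. (i, j) \<in> perm_rel \<pi>"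
proof -
  have set: "set \<pi> = {1..k}" and len: "length \<pi> = k"
    using assms by (auto simp: permutations_of_set_def distinct_card[symmetric])
  show "\<exists>j. (i, j) \<in> perm_rel \<pi>" if "i < k"
  proof -
    have "Suc i \<in> set \<pi>" using that by (simp add: set)
    then show ?thesis by (auto simp: in_set_conv_nth perm_rel_def)
  qed
  show "\<exists>i. (i, j) \<in> perm_rel \<pi>" if "j < k"
  proof -
    have "\<pi> ! j \<in> {1..k}" using that len set nth_mem[of j \<pi>] by auto
    then have "\<pi> ! j = Suc (\<pi> ! j - 1)" by simp
    then show ?thesis using that len by (auto simp: perm_rel_def)
  qed
qed

lemma perm_rel_inj:
  assumes "\<pi> \<in> permutations_of_set {1..k}"
  shows "inj_on fst (perm_rel \<pi>)" "inj_on snd (perm_rel \<pi>)"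
proof -
  have "distinct \<pi>" using assms by (auto simp: permutations_of_set_def)
  then have "j = j'" if "(i, j) \<in> perm_rel \<pi>" "(i, j') \<in> perm_rel \<pi>" for i j j'
    using that unfolding perm_rel_def by (metis (mono_tags, lifting) case_prodD mem_Collect_eq nth_eq_iff_index_eq)
  then show "inj_on fst (perm_rel \<pi>)" by (auto simp: inj_on_def)
  show "inj_on snd (perm_rel \<pi>)" by (auto simp: inj_on_def perm_rel_def)
qed

section \<open>Matrix containment as an occurrence among the 1-entries\<close>

definition ones :: "nat mat \<Rightarrow> (nat \<times> nat) set" where
  "ones M = {(i, j). i < dim_row M \<and> j < dim_col M \<and> M $$ (i, j) = 1}"

text \<open>\<open>pick\<close> enumerates a set in increasing order, so it recovers
  \<open>f\<close> from its image. This reads off the entries of a submatrix selected by such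
  images.\<close>

lemma pick_image_strict_mono:
  assumes f: "strict_mono_on {..<k::nat} (f :: nat \<Rightarrow> nat)" and i: "i < k"
  shows "pick (f ` {..<k}) i = f i"
proof -
  have inj: "inj_on f {..<k}" using f by (rule strict_mono_on_imp_inj_on)
  have "{a \<in> f ` {..<k}. a < f i} = f ` {..<i}"
    using i by (auto simp: strict_mono_on_less[OF f])
  moreover have "card (f ` {..<i}) = i"
    using card_image[OF inj_on_subset[OF inj, of "{..<i}"]] i by auto
  moreover have "f i \<in> f ` {..<k}" using i by simp
  ultimately show ?thesis using pick_card_in_set by metis
qed

text \<open>Containment yields an occurrence by picking rows and columns. Conversely, every row and
  every column of the permutation matrix holds exactly one 1, so an occurrence determines which rows
  and columns to select.\<close>

lemma mat_contains_perm_mat_iff: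
  assumes \<pi>: "\<pi> \<in> permutations_of_set {1..k}"
  shows "mat_contains M (perm_mat \<pi>) \<longleftrightarrow> occurs (perm_rel \<pi>) (ones M)"
proof
  have len: "length \<pi> = k"
    using \<pi> by (auto simp: permutations_of_set_def distinct_card[symmetric])
  have dims: "dim_row (perm_mat \<pi>) = k" "dim_col (perm_mat \<pi>) = k"
    by (simp_all add: perm_mat_def len)
  have entry: "perm_mat \<pi> $$ (i, j) = 1 \<longleftrightarrow> (i, j) \<in> perm_rel \<pi>" if "i < k" "j < k" for i j
    using that by (simp add: perm_mat_def perm_rel_def len)
  note bd = perm_rel_bounded[OF \<pi>]
  note inj = perm_rel_inj[OF \<pi>]
  {
    assume "mat_contains M (perm_mat \<pi>)"
    then obtain I J where car: "submatrix M I J \<in> carrier_mat k k"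
      and one: "\<And>i j. i < k \<Longrightarrow> j < k \<Longrightarrow> perm_mat \<pi> $$ (i, j) = 1 \<Longrightarrow> submatrix M I J $$ (i, j) = 1"
      unfolding mat_contains_def dims by blast
    have cI: "card {i. i < dim_row M \<and> i \<in> I} = k" and cJ: "card {j. j < dim_col M \<and> j \<in> J} = k"
      using car dim_submatrix[of M I J] by auto
    \<comment> \<open>The index sets may reach beyond the matrix, so \<open>pick\<close> is compared
      through their parts inside it.\<close>
    have mono: "pick X a < pick X b" if "a < b" "b < k" "k \<le> card {i. i < d \<and> i \<in> X}" for X a b and d :: nat
    proof -
      have "pick X a = pick {i. i < d \<and> i \<in> X} a" "pick X b = pick {i. i < d \<and> i \<in> X} b"
        using that by (intro pick_reduce_set; simp)+
      then show ?thesis using pick_mono[of b "{i. i < d \<and> i \<in> X}" a] that by simp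
    qed
    show "occurs (perm_rel \<pi>) (ones M)"
    proof (rule occursI[where \<phi> = "map_prod (pick I) (pick J)"])
      fix a assume a: "a \<in> perm_rel \<pi>"
      then have lt: "fst a < k" "snd a < k" using bd by auto
      then have "submatrix M I J $$ a = 1" using one[OF lt] entry[OF lt] a by simp
      then have "M $$ (pick I (fst a), pick J (snd a)) = 1"
        using submatrix_index[of "fst a" M I "snd a" J] lt cI cJ by simp
      moreover have "pick I (fst a) < dim_row M" "pick J (snd a) < dim_col M"
        using lt cI cJ by (intro pick_le; simp)+
      ultimately show "map_prod (pick I) (pick J) a \<in> ones M"
        by (cases a) (simp add: ones_def)
    next
      fix a b assume ab: "a \<in> perm_rel \<pi>" "b \<in> perm_rel \<pi>"
      then have lt: "fst b < k" "snd b < k" using bd by auto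
      show "fst a < fst b \<Longrightarrow> fst (map_prod (pick I) (pick J) a) < fst (map_prod (pick I) (pick J) b)"
        using mono[of "fst a" "fst b" "dim_row M" I] lt cI by simp
      show "snd a < snd b \<Longrightarrow> snd (map_prod (pick I) (pick J) a) < snd (map_prod (pick I) (pick J) b)"
        using mono[of "snd a" "snd b" "dim_col M" J] lt cJ by simp
    qed
  }
  {
    assume "occurs (perm_rel \<pi>) (ones M)"
    then obtain \<phi> where \<phi>: "\<And>a. a \<in> perm_rel \<pi> \<Longrightarrow> \<phi> a \<in> ones M"
      "\<And>a b. a \<in> perm_rel \<pi> \<Longrightarrow> b \<in> perm_rel \<pi> \<Longrightarrow> fst a < fst b \<Longrightarrow> fst (\<phi> a) < fst (\<phi> b)"
      "\<And>a b. a \<in> perm_rel \<pi> \<Longrightarrow> b \<in> perm_rel \<pi> \<Longrightarrow> snd a < snd b \<Longrightarrow> snd (\<phi> a) < snd (\<phi> b)"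
      by (rule occursE) blast
    \<comment> \<open>Row \<open>i\<close> of the permutation matrix has a single 1, so
      \<open>SOME\<close> returns its column, and \<open>f i\<close> is the row to which row
      \<open>i\<close> is sent; likewise \<open>g\<close> for columns.\<close>
    define f where "f i = fst (\<phi> (i, SOME j. (i, j) \<in> perm_rel \<pi>))" for i
    define g where "g j = snd (\<phi> (SOME i. (i, j) \<in> perm_rel \<pi>, j))" for j
    have f_mem: "(i, SOME j. (i, j) \<in> perm_rel \<pi>) \<in> perm_rel \<pi>" if "i < k" for i
      using perm_rel_total(1)[OF \<pi> that] by (rule someI_ex)
    have g_mem: "(SOME i. (i, j) \<in> perm_rel \<pi>, j) \<in> perm_rel \<pi>" if "j < k" for j
      using perm_rel_total(2)[OF \<pi> that] by (rule someI_ex)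
    have f_mono: "strict_mono_on {..<k} f"
      unfolding f_def by (rule strict_mono_onI) (use \<phi>(2) f_mem in auto)
    have g_mono: "strict_mono_on {..<k} g"
      unfolding g_def by (rule strict_mono_onI) (use \<phi>(3) g_mem in auto)
    have f_dim: "f i < dim_row M" if "i < k" for i
      using \<phi>(1)[OF f_mem[OF that]] by (auto simp: f_def ones_def)
    have g_dim: "g j < dim_col M" if "j < k" for j
      using \<phi>(1)[OF g_mem[OF that]] by (auto simp: g_def ones_def)
    have fg: "f i = fst (\<phi> (i, j))" "g j = snd (\<phi> (i, j))" if ij: "(i, j) \<in> perm_rel \<pi>" for i j
    proof -
      have "i < k" "j < k" using ij bd by auto
      then have "(i, SOME j. (i, j) \<in> perm_rel \<pi>) = (i, j)" "(SOME i. (i, j) \<in> perm_rel \<pi>, j) = (i, j)"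
        using inj_onD[OF inj(1) _ f_mem ij] inj_onD[OF inj(2) _ g_mem ij] by simp_all
      then show "f i = fst (\<phi> (i, j))" "g j = snd (\<phi> (i, j))" by (simp_all add: f_def g_def)
    qed
    let ?I = "f ` {..<k}" and ?J = "g ` {..<k}"
    have "{i. i < dim_row M \<and> i \<in> ?I} = ?I" "{j. j < dim_col M \<and> j \<in> ?J} = ?J"
      using f_dim g_dim by auto
    then have cI: "card {i. i < dim_row M \<and> i \<in> ?I} = k" and cJ: "card {j. j < dim_col M \<and> j \<in> ?J} = k"
      using strict_mono_on_imp_inj_on[OF f_mono] strict_mono_on_imp_inj_on[OF g_mono]
      by (simp_all add: card_image)
    show "mat_contains M (perm_mat \<pi>)"
      unfolding mat_contains_def dims
    proof (rule exI[of _ ?I], rule exI[of _ ?J], intro conjI allI impI)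
      show "submatrix M ?I ?J \<in> carrier_mat k k"
        using dim_submatrix[of M ?I ?J] cI cJ by (intro carrier_matI) simp_all
      fix i j assume ij: "i < k" "j < k" "perm_mat \<pi> $$ (i, j) = 1"
      then have mem: "(i, j) \<in> perm_rel \<pi>" using entry by simp
      have "submatrix M ?I ?J $$ (i, j) = M $$ (f i, g j)"
        using submatrix_index[of i M ?I j ?J] ij cI cJ
        by (simp add: pick_image_strict_mono[OF f_mono] pick_image_strict_mono[OF g_mono])
      then show "submatrix M ?I ?J $$ (i, j) = 1"
        using \<phi>(1)[OF mem] fg[OF mem] by (auto simp: ones_def)
    qed
  }
qed

section \<open>The extremal function over sets of positions\<close>

lemma ones_image_zero_one_mats: "ones ` zero_one_mats n = Pow ({..<n} \<times> {..<n})"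
proof
  show "ones ` zero_one_mats n \<subseteq> Pow ({..<n} \<times> {..<n})"
    by (auto simp: ones_def zero_one_mats_def)
  show "Pow ({..<n} \<times> {..<n}) \<subseteq> ones ` zero_one_mats n"
  proof
    fix S assume S: "S \<in> Pow ({..<n} \<times> {..<n})"
    let ?M = "mat n n (\<lambda>p. if p \<in> S then 1 else 0) :: nat mat"
    have "?M \<in> zero_one_mats n" by (auto simp: zero_one_mats_def elements_mat_def)
    moreover have "ones ?M = S" using S by (auto simp: ones_def split: if_splits)
    ultimately show "S \<in> ones ` zero_one_mats n" by blast
  qed
qed

lemma ex_perm_eq:
  assumes "\<pi> \<in> permutations_of_set {1..k}"
  shows "ex_perm \<pi> n = Max (card ` {S. S \<subseteq> {..<n} \<times> {..<n} \<and> \<not> occurs (perm_rel \<pi>) S})"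
proof -
  have num: "num_ones M = card (ones M)" for M by (simp add: num_ones_def ones_def)
  have "{num_ones M |M. M \<in> zero_one_mats n \<and> \<not> mat_contains M (perm_mat \<pi>)}
    = card ` {S. S \<in> ones ` zero_one_mats n \<and> \<not> occurs (perm_rel \<pi>) S}"
    unfolding mat_contains_perm_mat_iff[OF assms] num by auto
  then show ?thesis unfolding ex_perm_def ones_image_zero_one_mats by simp
qed

lemma finite_avoiders: "finite {S. S \<subseteq> {..<n::nat} \<times> {..<n::nat} \<and> \<not> occurs Q S}"
  by (rule finite_subset[of _ "Pow ({..<n} \<times> {..<n})"]) auto

lemma card_le_ex_perm:
  assumes "\<pi> \<in> permutations_of_set {1..k}" "S \<subseteq> {..<n} \<times> {..<n}" "\<not> occurs (perm_rel \<pi>) S"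
  shows "card S \<le> ex_perm \<pi> n"
  unfolding ex_perm_eq[OF assms(1)] using assms by (intro Max_ge finite_imageI finite_avoiders) auto

lemma ex_perm_attained:
  assumes "\<pi> \<in> permutations_of_set {1..k}" "0 < k"
  obtains S where "S \<subseteq> {..<n} \<times> {..<n}" "\<not> occurs (perm_rel \<pi>) S" "card S = ex_perm \<pi> n"
proof -
  \<comment> \<open>Positive \<open>k\<close> gives a nonempty pattern, so the empty set avoids it
    and the maximum is attained.\<close>
  have "\<not> occurs (perm_rel \<pi>) ({} :: (nat \<times> nat) set)"
    using perm_rel_total(1)[OF assms] by (auto simp: occurs_def)
  then have "{S. S \<subseteq> {..<n} \<times> {..<n} \<and> \<not> occurs (perm_rel \<pi>) S} \<noteq> {}" by blast
  then have "ex_perm \<pi> n \<in> card ` {S. S \<subseteq> {..<n} \<times> {..<n} \<and> \<not> occurs (perm_rel \<pi>) S}"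
    unfolding ex_perm_eq[OF assms(1)] by (intro Max_in finite_imageI finite_avoiders) auto
  then show ?thesis using that by auto
qed

lemma ex_perm_linear:
  assumes "\<pi> \<in> permutations_of_set {1..k}" "0 < k"
  obtains B where "\<And>n. ex_perm \<pi> n \<le> B * n"
proof -
  obtain B where "\<forall>n S. S \<subseteq> {..<n} \<times> {..<n} \<longrightarrow> \<not> occurs (perm_rel \<pi>) S \<longrightarrow> card S \<le> B * n"
    using marcus_tardos[OF perm_rel_bounded[OF assms(1)] assms(2)] by blast
  then have "ex_perm \<pi> n \<le> B * n" for n
    using ex_perm_attained[OF assms, of n] by metis
  then show ?thesis by (rule that)
qed

text \<open>Two avoiders are placed corner to corner.  The blocks ascend or descend according to whether
  the last entry of \<open>\<pi>\<close> is below or above the first one, so that an occurrence of \<open>\<pi>\<close> cannot use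
  both blocks.\<close>

lemma ex_perm_superadditive:
  assumes \<pi>: "\<pi> \<in> permutations_of_set {1..k}" and k: "2 \<le> k"
  shows "ex_perm \<pi> m + ex_perm \<pi> n \<le> ex_perm \<pi> (m + n)"
proof -
  have "0 < k" using k by simp
  obtain S1 where S1: "S1 \<subseteq> {..<m} \<times> {..<m}" "\<not> occurs (perm_rel \<pi>) S1" "card S1 = ex_perm \<pi> m"
    using ex_perm_attained[OF \<pi> \<open>0 < k\<close>] by blast
  obtain S2 where S2: "S2 \<subseteq> {..<n} \<times> {..<n}" "\<not> occurs (perm_rel \<pi>) S2" "card S2 = ex_perm \<pi> n"
    using ex_perm_attained[OF \<pi> \<open>0 < k\<close>] by blast
  obtain i0 i1 where i0: "(i0, 0) \<in> perm_rel \<pi>" and i1: "(i1, k - 1) \<in> perm_rel \<pi>"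
    using perm_rel_total(2)[OF \<pi>, of 0] perm_rel_total(2)[OF \<pi>, of "k - 1"] k by auto
  have "i0 \<noteq> i1" using inj_onD[OF perm_rel_inj(1)[OF \<pi>] _ i0 i1] k by auto
  define dn where "dn = (i1 < i0)"
  \<comment> \<open>The first block always occupies the left columns and only the rows depend on
    \<open>dn\<close>: if it fails, the first block is lifted above the \<open>n\<close> rows of the
    second.\<close>
  define u1 u2 where "u1 = (\<lambda>i::nat. if dn then i else i + n)" and "u2 = (\<lambda>i::nat. if dn then i + m else i)"
  define h1 h2 where "h1 = map_prod u1 (\<lambda>j::nat. j)" and "h2 = map_prod u2 (\<lambda>j. j + m)"
  define S where "S = h1 ` S1 \<union> h2 ` S2"
  have inj: "inj_on h1 S1" "inj_on h2 S2"
    by (auto simp: inj_on_def h1_def h2_def u1_def u2_def split: if_splits)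
  have S_bd: "S \<subseteq> {..<m + n} \<times> {..<m + n}"
    using S1(1) S2(1) by (auto simp: S_def h1_def h2_def u1_def u2_def)
  have left: "a \<in> h1 ` S1 \<longleftrightarrow> snd a < m" if "a \<in> S" for a
    using that S1(1) by (auto simp: S_def h1_def h2_def)
  have right: "a \<in> h2 ` S2 \<longleftrightarrow> m \<le> snd a" if "a \<in> S" for a
    using that S1(1) by (auto simp: S_def h1_def h2_def)
  have "\<not> occurs (perm_rel \<pi>) S"
  proof
    assume "occurs (perm_rel \<pi>) S"
    then obtain \<phi> where \<phi>: "\<And>a. a \<in> perm_rel \<pi> \<Longrightarrow> \<phi> a \<in> S"
      "\<And>a b. a \<in> perm_rel \<pi> \<Longrightarrow> b \<in> perm_rel \<pi> \<Longrightarrow> fst a < fst b \<Longrightarrow> fst (\<phi> a) < fst (\<phi> b)"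
      "\<And>a b. a \<in> perm_rel \<pi> \<Longrightarrow> b \<in> perm_rel \<pi> \<Longrightarrow> snd a < snd b \<Longrightarrow> snd (\<phi> a) < snd (\<phi> b)"
      by (rule occursE) blast
    have snd_le: "snd (\<phi> a) \<le> snd (\<phi> b)" if "a \<in> perm_rel \<pi>" "b \<in> perm_rel \<pi>" "snd a \<le> snd b" for a b
      using that \<phi>(3)[OF that(1,2)] inj_onD[OF perm_rel_inj(2)[OF \<pi>] _ that(1,2)]
      by (cases "snd a = snd b") auto
    \<comment> \<open>If the first column of the pattern fell into the right block, all others would
      follow, giving an occurrence in \<open>S2\<close>; symmetrically for the last column and
      \<open>S1\<close>.\<close>
    have l: "snd (\<phi> (i0, 0)) < m"
    proof (rule ccontr)
      assume "\<not> snd (\<phi> (i0, 0)) < m"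
      then have "m \<le> snd (\<phi> a)" if "a \<in> perm_rel \<pi>" for a
        using snd_le[OF i0 that] by simp
      then have "occurs (perm_rel \<pi>) (h2 ` S2)"
        using \<phi> right by (intro occursI[of _ \<phi>]) auto
      then show False
        using S2(2) occurs_map_prod[of S2 u2 "\<lambda>j. j + m" "perm_rel \<pi>"]
        by (auto simp: h2_def u2_def mono_on_def)
    qed
    have r: "m \<le> snd (\<phi> (i1, k - 1))"
    proof (rule ccontr)
      assume r: "\<not> m \<le> snd (\<phi> (i1, k - 1))"
      have "snd (\<phi> a) < m" if a: "a \<in> perm_rel \<pi>" for a
      proof -
        have "snd a \<le> k - 1" using a perm_rel_bounded[OF \<pi>] by auto
        then show ?thesis using snd_le[OF a i1] r by simp
      qed
      then have "occurs (perm_rel \<pi>) (h1 ` S1)"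
        using \<phi> left by (intro occursI[of _ \<phi>]) auto
      then show False
        using S1(2) occurs_map_prod[of S1 u1 "\<lambda>j. j" "perm_rel \<pi>"]
        by (auto simp: h1_def u1_def mono_on_def)
    qed
    have mem: "\<phi> (i0, 0) \<in> h1 ` S1" "\<phi> (i1, k - 1) \<in> h2 ` S2"
      using l r left right \<phi>(1)[OF i0] \<phi>(1)[OF i1] by auto
    show False
    proof (cases dn)
      case True
      then have "fst (\<phi> (i0, 0)) < fst (\<phi> (i1, k - 1))"
        using mem S1(1) S2(1) by (auto simp: h1_def h2_def u1_def u2_def)
      moreover have "fst (\<phi> (i1, k - 1)) < fst (\<phi> (i0, 0))"
        using \<phi>(2)[OF i1 i0] True by (simp add: dn_def)
      ultimately show False by simp
    next
      case False
      then have "fst (\<phi> (i1, k - 1)) < fst (\<phi> (i0, 0))"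
        using mem S1(1) S2(1) by (auto simp: h1_def h2_def u1_def u2_def)
      moreover have "fst (\<phi> (i0, 0)) < fst (\<phi> (i1, k - 1))"
        using \<phi>(2)[OF i0 i1] False \<open>i0 \<noteq> i1\<close> by (simp add: dn_def)
      ultimately show False by simp
    qed
  qed
  then have "card S \<le> ex_perm \<pi> (m + n)" using card_le_ex_perm[OF \<pi> S_bd] by simp
  moreover have "card S = card S1 + card S2"
  proof -
    have fin: "finite S1" "finite S2" using S1(1) S2(1) finite_subset by blast+
    have "h1 ` S1 \<inter> h2 ` S2 = {}" using S1(1) by (auto simp: h1_def h2_def)
    then show ?thesis unfolding S_def using fin inj by (simp add: card_Un_disjoint card_image)
  qed
  ultimately show ?thesis using S1(3) S2(3) by simp
qed

text \<open>The limit is the supremum of the ratios, finite by the linear bound; hence the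
  inequality for every single \<open>n\<close> along with the convergence.\<close>

lemma fekete:
  fixes u :: "nat \<Rightarrow> nat"
  assumes super: "\<And>m n. u m + u n \<le> u (m + n)" and bound: "\<And>n. u n \<le> B * n"
  obtains l :: real where "(\<lambda>n. real (u n) / real n) \<longlonglongrightarrow> l" "\<And>n. real (u n) \<le> l * real n"
proof -
  define X where "X = (\<lambda>n. real (u n) / real n) ` {1..}"
  have bdd: "bdd_above X"
  proof (rule bdd_aboveI)
    fix x assume "x \<in> X"
    then obtain n where n: "1 \<le> n" "x = real (u n) / real n" by (auto simp: X_def)
    have "real (u n) \<le> real B * real n" using bound[of n] by (metis of_nat_le_iff of_nat_mult)
    then show "x \<le> real B" using n by (simp add: divide_le_eq)
  qed
  define l where "l = Sup X"
  have le: "real (u n) / real n \<le> l" if "1 \<le> n" for n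
    unfolding l_def by (rule cSup_upper[OF _ bdd]) (use that in \<open>auto simp: X_def\<close>)
  have mult: "q * u p \<le> u (q * p)" for q p
  proof (induction q)
    case (Suc q)
    then show ?case using super[of p "q * p"] by simp
  qed simp
  \<comment> \<open>\<open>n div p\<close> copies of \<open>p\<close> fit into \<open>n\<close>;
    rounding \<open>n / p\<close> down costs at most one copy, that is \<open>u p\<close>.\<close>
  have low: "real n * (real (u p) / real p) - real (u p) \<le> real (u n)" if "1 \<le> p" for n p
  proof -
    have "n div p * u p + u (n mod p) \<le> u n"
      using mult[of "n div p" p] super[of "n div p * p" "n mod p"] by simp
    then have "real (n div p) * real (u p) \<le> real (u n)"
      by (metis add_leD1 of_nat_le_iff of_nat_mult)
    moreover have "real n / real p - 1 \<le> real (n div p)"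
      using floor_divide_of_nat_eq[of n p, where ?'a = real] by linarith
    then have "(real n / real p - 1) * real (u p) \<le> real (n div p) * real (u p)"
      by (rule mult_right_mono) simp
    ultimately show ?thesis by (simp add: algebra_simps)
  qed
  have "(\<lambda>n. real (u n) / real n) \<longlonglongrightarrow> l"
  proof (rule LIMSEQ_I)
    fix e :: real assume "0 < e"
    have "X \<noteq> {}" by (auto simp: X_def)
    then obtain p where p: "1 \<le> p" "l - e / 2 < real (u p) / real p"
      using less_cSup_iff[OF _ bdd, of "l - e / 2"] \<open>0 < e\<close> by (auto simp: l_def X_def)
    \<comment> \<open>From \<open>N\<close> on the loss \<open>u p / n\<close> stays below
      \<open>e / 2\<close>; the maximum with 1 keeps \<open>n\<close> positive.\<close>
    obtain N where N: "2 * real (u p) / e < real N" using reals_Archimedean2 by blast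
    show "\<exists>no. \<forall>n\<ge>no. norm (real (u n) / real n - l) < e"
    proof (intro exI[of _ "max 1 N"] allI impI)
      fix n assume n: "max 1 N \<le> n"
      then have "2 * real (u p) / e < real n" using N by linarith
      then have small: "real (u p) / real n < e / 2"
        using n \<open>0 < e\<close> by (simp add: field_simps)
      have "real (u p) / real p - real (u p) / real n \<le> real (u n) / real n"
        using divide_right_mono[OF low[OF p(1), of n], of "real n"] n by (simp add: diff_divide_distrib)
      then have "l - e < real (u n) / real n" using small p(2) by linarith
      then show "norm (real (u n) / real n - l) < e" using le[of n] n \<open>0 < e\<close> by simp
    qed
  qed
  \<comment> \<open>At \<open>n = 0\<close> the linear bound forces \<open>u 0 = 0\<close>.\<close>
  moreover have "real (u n) \<le> l * real n" for n
    using le[of n] bound[of 0] by (cases "n = 0") (auto simp: divide_le_eq)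
  ultimately show ?thesis by (rule that)
qed

text \<open>Fekete's lemma supplies a limit above every ratio, and convergence identifies it with
  the value of \<open>lim\<close>.\<close>

lemma ex_perm_le_FH_limit:
  assumes \<pi>: "\<pi> \<in> permutations_of_set {1..k}" and k: "2 \<le> k"
  shows "real (ex_perm \<pi> n) \<le> FH_limit \<pi> * real n"
proof -
  obtain B where B: "\<And>n. ex_perm \<pi> n \<le> B * n" using ex_perm_linear[OF \<pi>] k by auto
  obtain l where l: "(\<lambda>n. real (ex_perm \<pi> n) / real n) \<longlonglongrightarrow> l" "\<And>n. real (ex_perm \<pi> n) \<le> l * real n"
    using fekete[OF ex_perm_superadditive[OF \<pi> k] B] by blast
  then show ?thesis using limI[OF l(1)] by (simp add: FH_limit_def)
qed

text \<open>A pattern with two rows cannot fit into one cell, so a single 1 avoids it. The bound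
  lets additive constants be absorbed into the limit.\<close>

lemma one_le_FH_limit:
  assumes \<pi>: "\<pi> \<in> permutations_of_set {1..k}" and k: "2 \<le> k"
  shows "1 \<le> FH_limit \<pi>"
proof -
  obtain j0 j1 where j: "(0, j0) \<in> perm_rel \<pi>" "(1, j1) \<in> perm_rel \<pi>"
    using perm_rel_total(1)[OF \<pi>, of 0] perm_rel_total(1)[OF \<pi>, of 1] k by auto
  have "\<not> occurs (perm_rel \<pi>) {(0 :: nat, 0 :: nat)}"
    using j by (fastforce simp: occurs_def image_subset_iff)
  then have "card {(0 :: nat, 0 :: nat)} \<le> ex_perm \<pi> 1" by (intro card_le_ex_perm[OF \<pi>]) auto
  then show ?thesis using ex_perm_le_FH_limit[OF \<pi> k, of 1] by simp
qed

section \<open>Tours\<close>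

fun path_length :: "'a::metric_space list \<Rightarrow> real" where
  "path_length (x # y # zs) = dist x y + path_length (y # zs)"
| "path_length _ = 0"

lemma path_length_append: "path_length (xs @ y # zs) = path_length (xs @ [y]) + path_length (y # zs)"
  by (induction xs rule: path_length.induct) auto

text \<open>The step from \<open>q\<close> to the head of \<open>zs\<close> becomes a detour via
  \<open>p\<close>; the triangle inequality bounds its excess.\<close>

lemma path_length_insert:
  assumes "zs \<noteq> []"
  shows "path_length (q # p # zs) \<le> path_length (q # zs) + 2 * dist p q"
proof -
  obtain r rs where "zs = r # rs" using assms by (cases zs) auto
  moreover have "dist p r \<le> dist p q + dist q r" by (rule dist_triangle)
  ultimately show ?thesis by (simp add: dist_commute)
qed

lemma sum_list_dist_eq_path_length:
  "sum_list (map2 dist (x # xs) (xs @ [z])) = path_length (x # xs @ [z])"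
  by (induction xs arbitrary: x) auto

text \<open>As a path returning to its head, a tour has its closing edge as an ordinary step, so
  insertion is local.\<close>

lemma tour_length_eq_path_length: "xs \<noteq> [] \<Longrightarrow> tour_length xs = path_length (xs @ [hd xs])"
  by (cases xs) (auto simp: tour_length_def simp flip: sum_list_dist_eq_path_length)

lemma tour_length_insert:
  "tour_length (xs @ q # p # ys) \<le> tour_length (xs @ q # ys) + 2 * dist p q"
proof -
  \<comment> \<open>Inserting after \<open>q\<close> leaves the head of the tour unchanged, even
    when \<open>xs\<close> is empty.\<close>
  let ?h = "hd (xs @ [q])"
  have hd: "hd (xs @ q # zs) = ?h" for zs by (cases xs) auto
  have "tour_length (xs @ q # zs) = path_length (xs @ [q]) + path_length (q # zs @ [?h])" for zs
    using path_length_append[of xs q "zs @ [?h]"] tour_length_eq_path_length[of "xs @ q # zs"] hd[of zs]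
    by simp
  from this[of "p # ys"] this[of ys] show ?thesis
    using path_length_insert[of "ys @ [?h]" q p] by simp
qed

lemma TSP_le_tour_length:
  assumes "distinct xs" "set xs = P"
  shows "TSP P \<le> tour_length xs"
proof -
  have "xs \<in> permutations_of_set P" using assms by (simp add: permutations_of_set_def)
  then show ?thesis unfolding TSP_def by (intro Min_le finite_imageI) auto
qed

lemma TSP_empty [simp]: "TSP {} = 0"
  by (simp add: TSP_def tour_length_def)

lemma TSP_singleton [simp]: "TSP {p} = 0"
  by (simp add: TSP_def tour_length_def)

lemma TSP_attained:
  assumes "finite P"
  obtains xs where "distinct xs" "set xs = P" "tour_length xs = TSP P"
proof -
  have "permutations_of_set P \<noteq> {}" using assms by simp
  then have "TSP P \<in> tour_length ` permutations_of_set P"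
    unfolding TSP_def using assms by (intro Min_in) auto
  then show ?thesis using that by (auto simp: permutations_of_set_def)
qed

lemma TSP_insert_le:
  assumes "finite P" "q \<in> P" "p \<notin> P"
  shows "TSP (insert p P) \<le> TSP P + 2 * dist p q"
proof -
  obtain xs where xs: "distinct xs" "set xs = P" "tour_length xs = TSP P"
    using TSP_attained[OF assms(1)] .
  then obtain ys zs where "xs = ys @ q # zs" using assms(2) by (metis split_list)
  then have "TSP (insert p P) \<le> tour_length (ys @ q # p # zs)"
    using xs assms(3) by (intro TSP_le_tour_length) auto
  also have "\<dots> \<le> tour_length xs + 2 * dist p q"
    using tour_length_insert \<open>xs = _\<close> by simp
  finally show ?thesis using xs by simp
qed

section \<open>Dyadic cells\<close>

text \<open>Cells are indexed as matrix entries, row (the \<open>y\<close>-index) first.\<close>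

definition cell :: "nat \<Rightarrow> real \<times> real \<Rightarrow> nat \<times> nat" where
  "cell m p = (nat \<lfloor>real m * snd p\<rfloor>, nat \<lfloor>real m * fst p\<rfloor>)"

text \<open>Coordinate 1 falls into the additional index \<open>m\<close>, hence
  \<open>Suc m\<close>.\<close>

lemma cell_bound:
  assumes "P \<subseteq> {0..1} \<times> {0..1}"
  shows "cell m ` P \<subseteq> {..<Suc m} \<times> {..<Suc m}"
proof -
  have "nat \<lfloor>real m * x\<rfloor> < Suc m" if "0 \<le> x" "x \<le> 1" for x :: real
  proof -
    have "real m * x \<le> real m" using that mult_left_le by fastforce
    then have "\<lfloor>real m * x\<rfloor> \<le> int m" by (metis floor_mono floor_of_nat)
    then show ?thesis by linarith
  qed
  then show ?thesis using assms by (auto simp: cell_def)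
qed

lemma dist_le_of_cell_eq:
  assumes "p \<in> {0..1} \<times> {0..1}" "q \<in> {0..1} \<times> {0..1}" "0 < m" "cell m p = cell m q"
  shows "dist p q \<le> 2 / real m"
proof -
  have *: "dist x y \<le> 1 / real m"
    if "0 \<le> x" "0 \<le> y" "nat \<lfloor>real m * x\<rfloor> = nat \<lfloor>real m * y\<rfloor>" for x y :: real
  proof -
    \<comment> \<open>Nonnegative coordinates keep \<open>nat\<close> from merging different
      floors.\<close>
    have "\<lfloor>real m * x\<rfloor> = \<lfloor>real m * y\<rfloor>" using that by (simp add: eq_nat_nat_iff)
    then have "\<bar>real m * x - real m * y\<bar> \<le> 1" by linarith
    then have "real m * \<bar>x - y\<bar> \<le> 1"
      by (metis abs_mult abs_of_nat right_diff_distrib)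
    then show ?thesis using assms(3) by (simp add: dist_real_def field_simps)
  qed
  have "dist (fst p) (fst q) \<le> 1 / real m" "dist (snd p) (snd q) \<le> 1 / real m"
    using assms by (auto intro!: * simp: cell_def)
  moreover have "dist p q \<le> dist (fst p) (fst q) + dist (snd p) (snd q)"
    unfolding dist_prod_def by (rule sqrt_sum_squares_le_sum) auto
  ultimately show ?thesis by (simp add: field_simps)
qed

text \<open>Refine the scale step by step. If the next cell of \<open>p\<close> is occupied by
  \<open>P\<close>, any occupant is close enough; otherwise the old \<open>q\<close> is kept, and
  the new summand \<open>2 / 2 ^ L\<close> makes up for the smaller leading term. At scale 0 the
  bound 2 exceeds the diameter of the square.\<close>

lemma exists_close_point:
  assumes P: "P \<subseteq> {0..1} \<times> {0..1}" "P \<noteq> {}" and p: "p \<in> {0..1} \<times> {0..1}"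
  shows "\<exists>q\<in>P. dist p q \<le> 2 / 2 ^ L +
    (\<Sum>j<L. if cell (2 ^ Suc j) p \<in> cell (2 ^ Suc j) ` P then 0 else 2 / 2 ^ j)"
proof (induction L)
  case 0
  obtain q where "q \<in> P" using P by blast
  have "dist p q \<le> dist (fst p) (fst q) + dist (snd p) (snd q)"
    unfolding dist_prod_def by (rule sqrt_sum_squares_le_sum) auto
  moreover have "dist (fst p) (fst q) \<le> 1" "dist (snd p) (snd q) \<le> 1"
    using subsetD[OF P(1) \<open>q \<in> P\<close>] p by (auto simp: dist_real_def mem_Times_iff)
  ultimately show ?case using \<open>q \<in> P\<close> by (intro bexI[of _ q]) auto
next
  case (Suc L)
  let ?s = "\<lambda>L. \<Sum>j<L. if cell (2 ^ Suc j) p \<in> cell (2 ^ Suc j) ` P then 0 else 2 / 2 ^ j :: real"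
  have nonneg: "0 \<le> ?s L" for L by (rule sum_nonneg) auto
  show ?case
  proof (cases "cell (2 ^ Suc L) p \<in> cell (2 ^ Suc L) ` P")
    case True
    then obtain q where q: "q \<in> P" "cell (2 ^ Suc L) p = cell (2 ^ Suc L) q" by blast
    have "dist p q \<le> 2 / real (2 ^ Suc L)"
      by (rule dist_le_of_cell_eq) (use p P q in auto)
    then have "dist p q \<le> 2 / 2 ^ Suc L + ?s (Suc L)" using nonneg[of "Suc L"] by simp
    then show ?thesis using q by blast
  next
    case False
    obtain q where q: "q \<in> P" "dist p q \<le> 2 / 2 ^ L + ?s L" using Suc.IH by blast
    have "?s (Suc L) = ?s L + 2 / 2 ^ L" using False by simp
    moreover have "(0::real) \<le> 2 / 2 ^ Suc L" by simp
    ultimately have "dist p q \<le> 2 / 2 ^ Suc L + ?s (Suc L)" using q(2) by linarith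
    then show ?thesis using q by blast
  qed
qed

text \<open>Points are inserted one at a time. The factor 4 combines the detour factor 2 with the 2
  in the distance bound.\<close>

lemma TSP_le_cells:
  assumes "finite P" "P \<subseteq> {0..1} \<times> {0..1}"
  shows "TSP P \<le> 4 * (real (card P) / 2 ^ L + (\<Sum>j<L. real (card (cell (2 ^ Suc j) ` P)) / 2 ^ j))"
  using assms
proof (induction P rule: finite_induct)
  case empty
  then show ?case by simp
next
  case (insert p P)
  let ?s = "\<lambda>P. \<Sum>j<L. real (card (cell (2 ^ Suc j) ` P)) / 2 ^ j"
  show ?case
  proof (cases "P = {}")
    case True
    then show ?thesis by (simp add: sum_nonneg)
  next
    case False
    obtain q where q: "q \<in> P" "dist p q \<le> 2 / 2 ^ L +
        (\<Sum>j<L. if cell (2 ^ Suc j) p \<in> cell (2 ^ Suc j) ` P then 0 else 2 / 2 ^ j)"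
      using exists_close_point[of P p L] insert.prems False by blast
    \<comment> \<open>The cell count grows by one exactly at the scales that contribute to the
      distance bound for \<open>p\<close>.\<close>
    have "?s (insert p P) = ?s P + (\<Sum>j<L. if cell (2 ^ Suc j) p \<in> cell (2 ^ Suc j) ` P then 0 else 1 / 2 ^ j)"
      unfolding sum.distrib[symmetric] using insert.hyps(1)
      by (intro sum.cong) (auto simp: card_insert_if insert_absorb add_divide_distrib)
    moreover have "(\<Sum>j<L. if cell (2 ^ Suc j) p \<in> cell (2 ^ Suc j) ` P then 0 else 2 / 2 ^ j :: real)
      = 2 * (\<Sum>j<L. if cell (2 ^ Suc j) p \<in> cell (2 ^ Suc j) ` P then 0 else 1 / 2 ^ j)"
      unfolding sum_distrib_left by (intro sum.cong) auto
    moreover have "real (card (insert p P)) / 2 ^ L = real (card P) / 2 ^ L + 1 / 2 ^ L"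
      using insert.hyps by (simp add: add_divide_distrib)
    moreover have "TSP (insert p P) \<le> TSP P + 2 * dist p q"
      using TSP_insert_le insert.hyps q(1) by blast
    moreover have "TSP P \<le> 4 * (real (card P) / 2 ^ L + ?s P)" using insert by simp
    ultimately show ?thesis using q(2) by (simp only: distrib_left)
  qed
qed

section \<open>From occurrences among points and cells to patterns in the permutation\<close>

lemma (in linorder) sorted_key_list_of_set_inj_on:
  assumes "finite A" "inj_on f A"
  shows "set (sorted_key_list_of_set f A) = A" "sorted (map f (sorted_key_list_of_set f A))"
proof -
  interpret folding_insort_key "(\<le>)" "(<)" A f by standard (rule assms(2))
  show "set (sorted_key_list_of_set f A) = A" "sorted (map f (sorted_key_list_of_set f A))"
    using assms(1) by simp_all
qed

text \<open>Keys determine the elements of \<open>A\<close>, so it suffices to compare the sorted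
  key lists and pull back along the inverse of \<open>f\<close>.\<close>

lemma subseq_sorted_key_list_of_set:
  assumes "finite A" "inj_on f A" "set xs \<subseteq> A" "sorted_wrt (<) (map f xs)"
  shows "subseq xs (sorted_key_list_of_set f A)"
proof -
  let ?ys = "sorted_key_list_of_set f A"
  note ys = sorted_key_list_of_set_inj_on[OF assms(1,2)]
  have "subseq (map f xs) (map f ?ys)"
    using assms(3,4) ys by (intro sorted_subset_imp_subseq) auto
  then have "subseq (map (inv_into A f) (map f xs)) (map (inv_into A f) (map f ?ys))"
    by (rule subseq_map)
  moreover have "map (inv_into A f) (map f zs) = zs" if "set zs \<subseteq> A" for zs
    using that assms(2) by (auto intro!: map_idI)
  ultimately show ?thesis using assms(3) ys(1) by simp
qed

text \<open>The images of the 1-entries, taken column by column, are points with increasing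
  \<open>x\<close>, hence a subsequence of the sorted list; \<open>y_rank\<close> is strictly
  increasing in \<open>y\<close> on \<open>P\<close>, so their ranks are ordered like
  \<open>\<pi>\<close>.\<close>

lemma points_contain_of_occurs:
  assumes \<pi>: "\<pi> \<in> permutations_of_set {1..k}" and "finite P" "general_position P"
    and occ: "occurs (perm_rel \<pi>) (prod.swap ` P)"
  shows "\<not> points_avoid P \<pi>"
proof -
  have set: "set \<pi> = {1..k}" and len: "length \<pi> = k" and dist: "distinct \<pi>"
    using \<pi> by (auto simp: permutations_of_set_def distinct_card[symmetric])
  have inj: "inj_on fst P" "inj_on snd P" using assms(3) by (auto simp: general_position_def)
  obtain \<phi> where \<phi>: "\<And>a. a \<in> perm_rel \<pi> \<Longrightarrow> \<phi> a \<in> prod.swap ` P"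
      "\<And>a b. a \<in> perm_rel \<pi> \<Longrightarrow> b \<in> perm_rel \<pi> \<Longrightarrow> fst a < fst b \<Longrightarrow> fst (\<phi> a) < fst (\<phi> b)"
      "\<And>a b. a \<in> perm_rel \<pi> \<Longrightarrow> b \<in> perm_rel \<pi> \<Longrightarrow> snd a < snd b \<Longrightarrow> snd (\<phi> a) < snd (\<phi> b)"
    using occ by (rule occursE) blast
  \<comment> \<open>The point matched with position \<open>j\<close>, counted from 0. Entries start
    at 1, so its row is \<open>\<pi> ! j - 1\<close>; \<open>pos\<close> excludes truncated
    subtraction.\<close>
  define p where "p j = prod.swap (\<phi> (\<pi> ! j - 1, j))" for j
  have pos: "0 < \<pi> ! j" if "j < k" for j
    using that len set nth_mem[of j \<pi>] by auto
  then have mem: "(\<pi> ! j - 1, j) \<in> perm_rel \<pi>" if "j < k" for j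
    using that by (simp add: perm_rel_def len)
  have pP: "p j \<in> P" if "j < k" for j
    using \<phi>(1)[OF mem[OF that]] by (auto simp: p_def)
  have px: "fst (p i) < fst (p j)" if "i < j" "j < k" for i j
    using \<phi>(3)[OF mem mem, of i j] that by (simp add: p_def)
  have py: "snd (p i) < snd (p j)" if "i < k" "j < k" "\<pi> ! i < \<pi> ! j" for i j
    using \<phi>(2)[OF mem mem, of i j] that pos[of i] by (simp add: p_def)
  have rank: "y_rank P a < y_rank P b" if "a \<in> P" "b \<in> P" "snd a < snd b" for a b
  proof -
    have "b \<notin> {q \<in> P. snd q \<le> snd a}" "b \<in> {q \<in> P. snd q \<le> snd b}" using that by auto
    moreover have "{q \<in> P. snd q \<le> snd a} \<subseteq> {q \<in> P. snd q \<le> snd b}" using that by auto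
    ultimately show ?thesis
      unfolding y_rank_def using \<open>finite P\<close> by (intro psubset_card_mono) auto
  qed
  have rank': "y_rank P (p i) < y_rank P (p j)" if "i < k" "j < k" "\<pi> ! i < \<pi> ! j" for i j
    using rank pP py that by blast
  let ?ps = "map p [0..<k]"
  have "subseq ?ps (sorted_key_list_of_set fst P)"
    by (rule subseq_sorted_key_list_of_set)
      (use \<open>finite P\<close> inj pP px in \<open>auto simp: sorted_wrt_iff_nth_less\<close>)
  then have "subseq (map (y_rank P) ?ps) (point_perm P)"
    unfolding point_perm_def by (rule subseq_map)
  moreover have "order_isomorphic (map (y_rank P) ?ps) \<pi>"
    unfolding order_isomorphic_def
  proof (intro conjI allI impI)
    show "length (map (y_rank P) ?ps) = length \<pi>" by (simp add: len)
    fix i j assume "i < length (map (y_rank P) ?ps)" "j < length (map (y_rank P) ?ps)"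
    then have ij: "i < k" "j < k" by simp_all
    \<comment> \<open>Trichotomy turns the one-sided \<open>rank'\<close> into the equivalence that
      order isomorphism asks for.\<close>
    have "\<pi> ! i < \<pi> ! j \<or> i = j \<or> \<pi> ! j < \<pi> ! i"
      using dist ij len by (metis linorder_neqE_nat nth_eq_iff_index_eq)
    then have "y_rank P (p i) < y_rank P (p j) \<longleftrightarrow> \<pi> ! i < \<pi> ! j"
      using rank'[of i j] rank'[of j i] ij by auto
    then show "map (y_rank P) ?ps ! i < map (y_rank P) ?ps ! j \<longleftrightarrow> \<pi> ! i < \<pi> ! j"
      using ij by simp
  qed
  ultimately show ?thesis by (auto simp: points_avoid_def seq_contains_def)
qed

text \<open>The occupied cells are the image of the swapped points under a weakly increasing map in
  each coordinate, so a pattern among the cells would already occur among the points.\<close>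

lemma card_cells_le:
  assumes \<pi>: "\<pi> \<in> permutations_of_set {1..k}" and P: "finite P" "P \<subseteq> {0..1} \<times> {0..1}"
    and gp: "general_position P" and av: "points_avoid P \<pi>"
  shows "card (cell m ` P) \<le> ex_perm \<pi> (Suc m)"
proof (rule card_le_ex_perm[OF \<pi> cell_bound[OF P(2)]])
  let ?g = "\<lambda>x. nat \<lfloor>real m * x\<rfloor>"
  have cells: "cell m ` P = map_prod ?g ?g ` prod.swap ` P"
    unfolding image_comp by (rule image_cong) (auto simp: cell_def)
  have mono: "mono_on A ?g" for A
    by (intro mono_onI nat_mono floor_mono mult_left_mono) auto
  show "\<not> occurs (perm_rel \<pi>) (cell m ` P)"
    using points_contain_of_occurs[OF \<pi> P(1) gp] av occurs_map_prod[OF mono mono]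
    unfolding cells by blast
qed

section \<open>Summation over the dyadic scales\<close>

theorem theorem3p15:
  shows "\<exists>C::real. \<forall>(k::nat) (\<pi>::nat list) (P::(real \<times> real) set).
           \<pi> \<in> permutations_of_set {1..k} \<longrightarrow>
           finite P \<longrightarrow> P \<subseteq> {0..1} \<times> {0..1} \<longrightarrow> general_position P \<longrightarrow> points_avoid P \<pi> \<longrightarrow>
           TSP P \<le> C * FH_limit \<pi> * ln (real (card P))"
\<comment> \<open>With \<open>t = log 2 (card P)\<close> the final estimate is
  \<open>4 * (c * t + 2 * t * (3 * c)) = 28 * c * t\<close>, where \<open>c\<close> is the limit;
  \<open>ln 2\<close> converts the base of the logarithm.\<close>
proof (intro exI[of _ "28 / ln 2"] allI impI)
  fix k \<pi> and P :: "(real \<times> real) set"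
  assume \<pi>: "\<pi> \<in> permutations_of_set {1..k}" and P: "finite P" "P \<subseteq> {0..1} \<times> {0..1}"
    and gp: "general_position P" and av: "points_avoid P \<pi>"
  let ?c = "FH_limit \<pi>"
  show "TSP P \<le> 28 / ln 2 * ?c * ln (real (card P))"
  proof (cases "card P \<le> 1")
    case True
    \<comment> \<open>Both sides vanish, as \<open>ln\<close> is 0 at 1 and, by convention, at
      0.\<close>
    then have "P = {} \<or> (\<exists>p. P = {p})"
      using P(1) by (metis card_0_eq card_1_singletonE le_neq_implies_less less_one)
    then show ?thesis by auto
  next
    case False
    then have n: "2 \<le> card P" by simp
    then have "P \<noteq> {}" by auto
    then obtain p where "p \<in> P" by blast
    \<comment> \<open>A pattern of length at most 1 occurs in every nonempty set, by a constant
      map.\<close>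
    have k: "2 \<le> k"
    proof (rule ccontr)
      assume "\<not> 2 \<le> k"
      then have "occurs (perm_rel \<pi>) (prod.swap ` P)"
        using perm_rel_bounded[OF \<pi>] \<open>p \<in> P\<close>
        by (intro occursI[where \<phi> = "\<lambda>_. prod.swap p"]) auto
      then show False using points_contain_of_occurs[OF \<pi> P(1) gp] av by blast
    qed
    have c: "1 \<le> ?c" by (rule one_le_FH_limit[OF \<pi> k])
    define t where "t = log 2 (real (card P))"
    have t: "1 \<le> t" using n by (simp add: t_def le_log_iff)
    \<comment> \<open>At this depth \<open>2 ^ L\<close> is at least the number of points, so the
      term \<open>card P / 2 ^ L\<close> is at most 1; \<open>t \<ge> 1\<close> bounds the rounding
      by a factor 2.\<close>
    define L where "L = nat \<lceil>t\<rceil>"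
    have L: "t \<le> real L" "real L \<le> 2 * t" using t unfolding L_def by linarith+
    have "real (card P) = 2 powr t" using n by (simp add: t_def)
    also have "\<dots> \<le> 2 ^ L" using L(1) by (simp flip: powr_realpow)
    finally have small: "real (card P) / 2 ^ L \<le> 1" by simp
    have "real (card (cell (2 ^ Suc j) ` P)) / 2 ^ j \<le> 3 * ?c" for j
    proof -
      have "real (card (cell (2 ^ Suc j) ` P)) \<le> ?c * real (Suc (2 ^ Suc j))"
        using card_cells_le[OF \<pi> P gp av, of "2 ^ Suc j"] ex_perm_le_FH_limit[OF \<pi> k, of "Suc (2 ^ Suc j)"]
        by linarith
      \<comment> \<open>The additional row and column of cells are absorbed by
        \<open>2 ^ Suc j + 1 \<le> 3 * 2 ^ j\<close>.\<close>
      also have "\<dots> \<le> ?c * (3 * 2 ^ j)"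
        using c by (intro mult_left_mono) auto
      finally show ?thesis by (simp add: divide_le_eq mult_ac)
    qed
    then have sum_le: "(\<Sum>j<L. real (card (cell (2 ^ Suc j) ` P)) / 2 ^ j) \<le> real L * (3 * ?c)"
      using sum_mono[of "{..<L}" _ "\<lambda>_. 3 * ?c"] by simp
    have "TSP P \<le> 4 * (real (card P) / 2 ^ L + (\<Sum>j<L. real (card (cell (2 ^ Suc j) ` P)) / 2 ^ j))"
      by (rule TSP_le_cells[OF P])
    also have "\<dots> \<le> 4 * (1 + real L * (3 * ?c))"
      by (intro mult_left_mono add_mono small sum_le) simp
    \<comment> \<open>The additive 1 is absorbed since both \<open>?c\<close> and \<open>t\<close>
      are at least 1.\<close>
    also have "\<dots> \<le> 4 * (?c * t + 2 * t * (3 * ?c))"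
      using c t L mult_mono[of 1 ?c 1 t] by (intro mult_left_mono add_mono mult_right_mono) auto
    also have "\<dots> = 28 / ln 2 * ?c * ln (real (card P))"
      by (simp add: t_def log_def)
    finally show ?thesis .
  qed
qed

end
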